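(* Let $X$ be a Hausdorff space and let $\{\omega^{D_\lambda}_\cdot\}$ be a Radon harmonic measure system on $X$. Suppose $D\in\{D_\lambda\}$ and $A\subseteq D$. If the Radon–Nikodym derivative $\frac{\mathrm{d}\omega^D_x}{\mathrm{d}\omega^D_y}(z)$ is bounded with respect to $x,y\in A$ and $z\in\partial D$, then $H(A;D)<+\infty$.
   Context: Measures: a measure on a set $Y$ is a map $\omega:2^Y\to[0,\infty]$ with $\omega(\emptyset)=0$ and countable subadditivity (an outer measure); measurability is in the sense of Carathéodory; it is Borel if every Borel set is measurable. It is Radon if it is Borel regular (Borel, and every set is contained in a Borel set of the same measure) and finite on compact sets. $\nu\ll\mu$ means $\mu(A)=0\Rightarrow\nu(A)=0$ for all $A\subseteq Y$. Write $\omega(f)=\int f\,\mathrm d\omega$. Pre-harmonic measure: let $D\subset X$ be open with $\partial D\neq\emptyset$. A family of Borel measures $\{\omega^D_x:2^{\partial D}\to[0,1]:x\in D\}$ on $\partial D$ is a pre-harmonic measure relative to $D$ if for every connected component $V$ of $D$: (1) $\omega_x^D(\partial V)=1$ for all $x\in V$; (2) $\omega^D_x\ll\omega^D_y$ for all $x,y\in V$. Harmonic measure: let $\mathcal F_x=\{E\Delta N: E\subseteq\partial D\text{ Borel},\ N\subseteq\partial D,\ \omega_x^D(N)=0\}$ and $\mathcal F=\bigcap_{x\in D}\mathcal F_x$. Functions measurable w.r.t. $\mathcal F$ are called $\omega_\cdot^D$-measurable. The pre-harmonic measure restricted to $\mathcal F$ is the harmonic measure $\omega_\cdot^D$ relative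 to $D$. $L(\partial D;\omega_\cdot^D)$ is the set of $\omega_\cdot^D$-measurable $f$ on $\partial D$ integrable with respect to $\omega_x^D$ for every $x\in D$. $\omega_\cdot^D$ is continuous if $x\mapsto\omega_x^D(f)$ is continuous on $D$ for every $f\in L(\partial D;\omega_\cdot^D)$. Convention: $\omega_y^D(f):=f(y)$ for $y\in\partial D$. Harmonic measure system: a family of continuous harmonic measures $\{\omega_\cdot^{D_\lambda}\}$ which is compatible: for any $D,\widetilde D\in\{D_\lambda\}$ with $D\cap\widetilde D\ne\emptyset$, any $f\in L(\partial D;\omega_\cdot^D)$ and $\widetilde f\in L(\partial\widetilde D;\omega_\cdot^{\widetilde D})$ such that $\omega_y^{\widetilde D}(\widetilde f)=f(y)$ for all $y\in\widetilde D\cap\partial D$ and $\omega_y^D(f)=\widetilde f(y)$ for all $y\in\partial\widetilde D\cap\overline D$, one has $\omega_x^D(f)=\omega_x^{\widetilde D}(\widetilde f)$ for all $x\in D\cap\widetilde D$. It is a Radon harmonic measure system if all the measures $\omega_x^{D_\lambda}$ are Radon. Harnack index: for $A\subseteq D\in\{D_\lambda\}$, $$H(A;D):=\sup\left\{\frac{\omega_x^D(f)}{\omega_y^D(f)}:\ x,y\in A,\ f\in L(\partial D;\omega_\cdot^D)\setminus\{0\},\ f\ge0\right\}\in[1,+\infty],$$ where functions agreeing off an $\omega_\cdot^D$-null set (null for all $\omega_x^D$, $x\in D$) are identified. *)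

theory Defs
  imports "HOL-Analysis.Analysis"
begin

text \<open>
  Following the convention of geometric measure theory, a measure on \<open>Y\<close> is an outer measure
  defined on all subsets of \<open>Y\<close>. It is represented by a set function of which only the values on
  \<open>Pow Y\<close> matter.
\<close>

abbreviation measure_on :: "'a set \<Rightarrow> ('a set \<Rightarrow> ennreal) \<Rightarrow> bool" where
  "measure_on Y \<mu> \<equiv> outer_measure_space (Pow Y) \<mu>"

abbreviation borel_sets_on :: "'a::topological_space set \<Rightarrow> 'a set set" where
  "borel_sets_on Y \<equiv> sets (restrict_space borel Y)"

text \<open>\<^const>\<open>lambda_system\<close> is the collection of Caratheodory measurable sets.\<close>

definition borel_measure_on :: "'a::topological_space set \<Rightarrow> ('a set \<Rightarrow> ennreal) \<Rightarrow> bool" where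
  "borel_measure_on Y \<mu> \<longleftrightarrow>
     measure_on Y \<mu> \<and> borel_sets_on Y \<subseteq> lambda_system Y (Pow Y) \<mu>"

definition borel_regular_on :: "'a::topological_space set \<Rightarrow> ('a set \<Rightarrow> ennreal) \<Rightarrow> bool" where
  "borel_regular_on Y \<mu> \<longleftrightarrow>
     borel_measure_on Y \<mu> \<and> (\<forall>A\<subseteq>Y. \<exists>B\<in>borel_sets_on Y. A \<subseteq> B \<and> \<mu> B = \<mu> A)"

definition radon_measure_on :: "'a::topological_space set \<Rightarrow> ('a set \<Rightarrow> ennreal) \<Rightarrow> bool" where
  "radon_measure_on Y \<mu> \<longleftrightarrow>
     borel_regular_on Y \<mu> \<and> (\<forall>K\<subseteq>Y. compact K \<longrightarrow> \<mu> K < \<infinity>)"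

definition abs_cont_on :: "'a set \<Rightarrow> ('a set \<Rightarrow> ennreal) \<Rightarrow> ('a set \<Rightarrow> ennreal) \<Rightarrow> bool" where
  "abs_cont_on Y \<nu> \<mu> \<longleftrightarrow> (\<forall>A\<subseteq>Y. \<mu> A = 0 \<longrightarrow> \<nu> A = 0)"

text \<open>
  The measures of a family relative to \<open>D\<close> live on \<open>frontier D\<close>. For a component \<open>V\<close> of \<open>D\<close> the
  set \<open>frontier V\<close> is contained in \<open>frontier D\<close> if the space is locally connected; in general
  the part of it inside \<open>frontier D\<close> is measured.
\<close>

definition pre_harmonic_measure ::
    "'a::topological_space set \<Rightarrow> ('a \<Rightarrow> 'a set \<Rightarrow> ennreal) \<Rightarrow> bool" where
  "pre_harmonic_measure D \<omega> \<longleftrightarrow>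
     open D \<and> frontier D \<noteq> {} \<and>
     (\<forall>x\<in>D. borel_measure_on (frontier D) (\<omega> x) \<and> (\<forall>E\<subseteq>frontier D. \<omega> x E \<le> 1)) \<and>
     (\<forall>V\<in>components D.
        (\<forall>x\<in>V. \<omega> x (frontier V \<inter> frontier D) = 1) \<and>
        (\<forall>x\<in>V. \<forall>y\<in>V. abs_cont_on (frontier D) (\<omega> x) (\<omega> y)))"

definition completed_borel_sets ::
    "'a::topological_space set \<Rightarrow> ('a set \<Rightarrow> ennreal) \<Rightarrow> 'a set set" where
  "completed_borel_sets Y \<mu> =
     {sym_diff E N | E N. E \<in> borel_sets_on Y \<and> N \<subseteq> Y \<and> \<mu> N = 0}"

definition harmonic_sets ::
    "'a::topological_space set \<Rightarrow> ('a \<Rightarrow> 'a set \<Rightarrow> ennreal) \<Rightarrow> 'a set set" where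
  "harmonic_sets D \<omega> = (\<Inter>x\<in>D. completed_borel_sets (frontier D) (\<omega> x))"

text \<open>
  The restriction of \<open>\<omega> x\<close> to the sigma-algebra \<^const>\<open>harmonic_sets\<close>; see the lemmas
  \<open>sets_harmonic_measure\<close> and \<open>emeasure_harmonic_measure\<close> below.
\<close>

definition harmonic_measure ::
    "'a::topological_space set \<Rightarrow> ('a \<Rightarrow> 'a set \<Rightarrow> ennreal) \<Rightarrow> 'a \<Rightarrow> 'a measure" where
  "harmonic_measure D \<omega> x = measure_of (frontier D) (harmonic_sets D \<omega>) (\<omega> x)"

text \<open>
  Functions on \<open>frontier D\<close> are represented by total functions; their values elsewhere are never
  used. Measurability with respect to \<^const>\<open>harmonic_sets\<close> is part of \<^const>\<open>integrable\<close>.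
\<close>

definition harmonic_L ::
    "'a::topological_space set \<Rightarrow> ('a \<Rightarrow> 'a set \<Rightarrow> ennreal) \<Rightarrow> ('a \<Rightarrow> real) set" where
  "harmonic_L D \<omega> = {f. \<forall>x\<in>D. integrable (harmonic_measure D \<omega> x) f}"

text \<open>The value of \<open>\<omega> x\<close> at \<open>f\<close>, extended to \<open>x \<in> frontier D\<close> by \<open>f x\<close>.\<close>

definition harmonic_value ::
    "'a::topological_space set \<Rightarrow> ('a \<Rightarrow> 'a set \<Rightarrow> ennreal) \<Rightarrow> 'a \<Rightarrow> ('a \<Rightarrow> real) \<Rightarrow> real" where
  "harmonic_value D \<omega> x f =
     (if x \<in> D then integral\<^sup>L (harmonic_measure D \<omega> x) f else f x)"

definition continuous_harmonic_measure ::
    "'a::topological_space set \<Rightarrow> ('a \<Rightarrow> 'a set \<Rightarrow> ennreal) \<Rightarrow> bool" where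
  "continuous_harmonic_measure D \<omega> \<longleftrightarrow>
     pre_harmonic_measure D \<omega> \<and>
     (\<forall>f\<in>harmonic_L D \<omega>. continuous_on D (\<lambda>x. harmonic_value D \<omega> x f))"

definition compatible_harmonic_measures ::
    "'a::topological_space set \<Rightarrow> ('a \<Rightarrow> 'a set \<Rightarrow> ennreal) \<Rightarrow>
     'a set \<Rightarrow> ('a \<Rightarrow> 'a set \<Rightarrow> ennreal) \<Rightarrow> bool" where
  "compatible_harmonic_measures D \<omega> D' \<omega>' \<longleftrightarrow>
     (\<forall>f\<in>harmonic_L D \<omega>. \<forall>f'\<in>harmonic_L D' \<omega>'.
        (\<forall>y\<in>D' \<inter> frontier D. harmonic_value D' \<omega>' y f' = f y) \<longrightarrow>
        (\<forall>y\<in>frontier D' \<inter> closure D. harmonic_value D \<omega> y f = f' y) \<longrightarrow>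
        (\<forall>x\<in>D \<inter> D'. harmonic_value D \<omega> x f = harmonic_value D' \<omega>' x f'))"

text \<open>A family of harmonic measures is indexed by its domains: \<open>\<omega> D\<close> is the one relative to \<open>D\<close>.\<close>

definition harmonic_measure_system ::
    "'a::topological_space set set \<Rightarrow> ('a set \<Rightarrow> 'a \<Rightarrow> 'a set \<Rightarrow> ennreal) \<Rightarrow> bool" where
  "harmonic_measure_system \<D> \<omega> \<longleftrightarrow>
     (\<forall>D\<in>\<D>. continuous_harmonic_measure D (\<omega> D)) \<and>
     (\<forall>D\<in>\<D>. \<forall>D'\<in>\<D>. D \<inter> D' \<noteq> {} \<longrightarrow> compatible_harmonic_measures D (\<omega> D) D' (\<omega> D'))"

definition radon_harmonic_measure_system ::
    "'a::topological_space set set \<Rightarrow> ('a set \<Rightarrow> 'a \<Rightarrow> 'a set \<Rightarrow> ennreal) \<Rightarrow> bool" where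
  "radon_harmonic_measure_system \<D> \<omega> \<longleftrightarrow>
     harmonic_measure_system \<D> \<omega> \<and>
     (\<forall>D\<in>\<D>. \<forall>x\<in>D. radon_measure_on (frontier D) (\<omega> D x))"

definition harmonic_null ::
    "'a::topological_space set \<Rightarrow> ('a \<Rightarrow> 'a set \<Rightarrow> ennreal) \<Rightarrow> 'a set \<Rightarrow> bool" where
  "harmonic_null D \<omega> N \<longleftrightarrow> N \<subseteq> frontier D \<and> (\<forall>x\<in>D. \<omega> x N = 0)"

text \<open>
  Functions agreeing off a null set are identified, so \<open>f \<noteq> 0\<close> and \<open>f \<ge> 0\<close> are read modulo null
  sets. In \<^typ>\<open>ennreal\<close> we have \<open>a / 0 = \<infinity>\<close> for \<open>a > 0\<close> and \<open>0 / 0 = 0\<close>; quotients \<open>0 / 0\<close>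
  (which can occur only if \<open>D\<close> is disconnected) therefore do not contribute to the supremum.
\<close>

definition harnack_index ::
    "'a::topological_space set \<Rightarrow> 'a set \<Rightarrow> ('a \<Rightarrow> 'a set \<Rightarrow> ennreal) \<Rightarrow> ennreal" where
  "harnack_index A D \<omega> =
     Sup {ennreal (harmonic_value D \<omega> x f) / ennreal (harmonic_value D \<omega> y f) | x y f.
            x \<in> A \<and> y \<in> A \<and> f \<in> harmonic_L D \<omega> \<and>
            \<not> harmonic_null D \<omega> {z \<in> frontier D. f z \<noteq> 0} \<and>
            harmonic_null D \<omega> {z \<in> frontier D. f z < 0}}"


lemma space_measure_of_lambda_system:
  assumes "measure_on Y \<mu>"
  defines "M \<equiv> measure_of Y (lambda_system Y (Pow Y) \<mu>) \<mu>"
  shows "space M = Y" "sets M = lambda_system Y (Pow Y) \<mu>"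
    "\<And>E. E \<in> lambda_system Y (Pow Y) \<mu> \<Longrightarrow> emeasure M E = \<mu> E"
proof -
  interpret P: sigma_algebra Y "Pow Y" by (rule sigma_algebra_Pow)
  have ms: "measure_space Y (lambda_system Y (Pow Y) \<mu>) \<mu>"
    by (rule P.caratheodory_lemma) (rule assms)
  then interpret L: sigma_algebra Y "lambda_system Y (Pow Y) \<mu>"
    by (simp add: measure_space_def)
  show "space M = Y" "sets M = lambda_system Y (Pow Y) \<mu>"
    by (simp_all add: M_def L.space_closed L.sets_measure_of_eq)
  show "emeasure M E = \<mu> E" if "E \<in> lambda_system Y (Pow Y) \<mu>" for E
    unfolding M_def using ms that
    by (intro emeasure_measure_of_sigma) (auto simp: measure_space_def)
qed

lemma null_in_lambda_system:
  assumes "measure_on Y \<mu>" "N \<subseteq> Y" "\<mu> N = 0"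
  shows "N \<in> lambda_system Y (Pow Y) \<mu>"
proof -
  have inc: "increasing (Pow Y) \<mu>" and pos: "positive (Pow Y) \<mu>"
    and csa: "countably_subadditive (Pow Y) \<mu>"
    using assms(1) by (auto simp: outer_measure_space_def)
  interpret P: sigma_algebra Y "Pow Y" by (rule sigma_algebra_Pow)
  have sa: "subadditive (Pow Y) \<mu>"
    by (rule P.countably_subadditive_subadditive[OF pos csa])
  have "\<mu> (N \<inter> A) + \<mu> ((Y - N) \<inter> A) = \<mu> A" if A: "A \<subseteq> Y" for A
  proof -
    have "\<mu> (N \<inter> A) \<le> \<mu> N"
      using inc assms(2) unfolding increasing_def by (meson Int_lower1 Pow_iff order_trans)
    then have 0: "\<mu> (N \<inter> A) = 0" using assms by simp
    have le: "\<mu> ((Y - N) \<inter> A) \<le> \<mu> A"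
      using inc A unfolding increasing_def by (meson Int_lower2 Pow_iff order_trans)
    have "\<mu> ((N \<inter> A) \<union> ((Y - N) \<inter> A)) \<le> \<mu> (N \<inter> A) + \<mu> ((Y - N) \<inter> A)"
      using A by (intro subadditiveD[OF sa]) auto
    moreover have "(N \<inter> A) \<union> ((Y - N) \<inter> A) = A" using A by auto
    ultimately show ?thesis using 0 le by simp
  qed
  then show ?thesis using assms(2) by (auto simp: lambda_system_def)
qed

lemma completed_borel_sets_iff:
  "A \<in> completed_borel_sets Y \<mu> \<longleftrightarrow>
     A \<subseteq> Y \<and> (\<exists>E\<in>borel_sets_on Y. \<mu> (sym_diff A E) = 0)"
proof
  assume "A \<in> completed_borel_sets Y \<mu>"
  then obtain E N where EN: "A = sym_diff E N" "E \<in> borel_sets_on Y" "N \<subseteq> Y" "\<mu> N = 0"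
    unfolding completed_borel_sets_def by auto
  have "E \<subseteq> Y" using sets.sets_into_space[OF EN(2)] by (simp add: space_restrict_space)
  moreover have "sym_diff A E = N" using EN by auto
  ultimately show "A \<subseteq> Y \<and> (\<exists>E\<in>borel_sets_on Y. \<mu> (sym_diff A E) = 0)"
    using EN by (intro conjI bexI[of _ E]) auto
next
  assume "A \<subseteq> Y \<and> (\<exists>E\<in>borel_sets_on Y. \<mu> (sym_diff A E) = 0)"
  then obtain E where E: "A \<subseteq> Y" "E \<in> borel_sets_on Y" "\<mu> (sym_diff A E) = 0" by auto
  have "E \<subseteq> Y" using sets.sets_into_space[OF E(2)] by (simp add: space_restrict_space)
  moreover have "A = sym_diff E (sym_diff A E)" by auto
  ultimately show "A \<in> completed_borel_sets Y \<mu>"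
    unfolding completed_borel_sets_def using E by blast
qed

lemma completed_borel_sets_sigma_algebra:
  assumes bm: "borel_measure_on Y \<mu>"
  shows "sigma_algebra Y (completed_borel_sets Y \<mu>)"
    and "completed_borel_sets Y \<mu> \<subseteq> lambda_system Y (Pow Y) \<mu>"
proof -
  have om: "measure_on Y \<mu>" and sub: "borel_sets_on Y \<subseteq> lambda_system Y (Pow Y) \<mu>"
    using bm by (auto simp: borel_measure_on_def)
  define M where "M = measure_of Y (lambda_system Y (Pow Y) \<mu>) \<mu>"
  note M = space_measure_of_lambda_system[OF om, folded M_def]
  have inc: "increasing (Pow Y) \<mu>"
    using om by (auto simp: outer_measure_space_def)
  have nullM: "N \<in> null_sets M \<longleftrightarrow> N \<subseteq> Y \<and> \<mu> N = 0" for N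
    using M null_in_lambda_system[OF om] lambda_system_sets[of N Y "Pow Y" \<mu>]
    by (auto simp: null_sets_def)
  have BY: "E \<subseteq> Y" if "E \<in> borel_sets_on Y" for E
    using sets.sets_into_space[OF that] by (simp add: space_restrict_space)
  have iff: "A \<in> completed_borel_sets Y \<mu> \<longleftrightarrow>
      A \<subseteq> Y \<and> (\<exists>E\<in>borel_sets_on Y. sym_diff A E \<in> null_sets M)" for A
  proof -
    have "A \<subseteq> Y \<Longrightarrow> E \<in> borel_sets_on Y \<Longrightarrow> sym_diff A E \<subseteq> Y" for E
      using BY[of E] by (meson Diff_subset Un_least order_trans)
    then show ?thesis unfolding completed_borel_sets_iff nullM by meson
  qed
  show "completed_borel_sets Y \<mu> \<subseteq> lambda_system Y (Pow Y) \<mu>"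
  proof
    fix A assume "A \<in> completed_borel_sets Y \<mu>"
    then obtain E where E: "A \<subseteq> Y" "E \<in> borel_sets_on Y" "sym_diff A E \<in> null_sets M"
      unfolding iff by auto
    have "E \<in> sets M" using E sub M by auto
    moreover have "sym_diff A E \<in> sets M" using E by auto
    ultimately have "sym_diff E (sym_diff A E) \<in> sets M"
      by (metis sets.Un sets.Diff)
    moreover have "sym_diff E (sym_diff A E) = A" by auto
    ultimately show "A \<in> lambda_system Y (Pow Y) \<mu>" using M by simp
  qed
  show "sigma_algebra Y (completed_borel_sets Y \<mu>)"
    unfolding sigma_algebra_iff2
  proof (intro conjI ballI allI impI)
    show "completed_borel_sets Y \<mu> \<subseteq> Pow Y" by (auto simp: completed_borel_sets_iff)
    show "{} \<in> completed_borel_sets Y \<mu>" unfolding iff by (auto intro!: bexI[of _ "{}"])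
  next
    fix A assume "A \<in> completed_borel_sets Y \<mu>"
    then obtain E where E: "A \<subseteq> Y" "E \<in> borel_sets_on Y" "sym_diff A E \<in> null_sets M"
      unfolding iff by auto
    have "sym_diff (Y - A) (Y - E) = sym_diff A E" using E BY by blast
    moreover have "Y - E \<in> borel_sets_on Y"
      using sets.compl_sets[OF E(2)] by (simp add: space_restrict_space)
    ultimately show "Y - A \<in> completed_borel_sets Y \<mu>"
      unfolding iff using E by (intro conjI bexI[of _ "Y - E"]) auto
  next
    fix A :: "nat \<Rightarrow> 'a set" assume "range A \<subseteq> completed_borel_sets Y \<mu>"
    then have "\<forall>i. A i \<in> completed_borel_sets Y \<mu>" by auto
    then have AY: "\<And>i. A i \<subseteq> Y"
      and "\<forall>i. \<exists>E. E \<in> borel_sets_on Y \<and> sym_diff (A i) E \<in> null_sets M"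
      unfolding iff by blast+
    then obtain E where E: "\<And>i. E i \<in> borel_sets_on Y" "\<And>i. sym_diff (A i) (E i) \<in> null_sets M"
      by metis
    have UE: "(\<Union>i. E i) \<in> borel_sets_on Y" using E(1) by (intro sets.countable_UN) auto
    have "(\<Union>i. sym_diff (A i) (E i)) \<in> null_sets M" using E(2) by (rule null_sets_UN)
    then have n: "\<mu> (\<Union>i. sym_diff (A i) (E i)) = 0" "(\<Union>i. sym_diff (A i) (E i)) \<subseteq> Y"
      unfolding nullM by auto
    have s: "sym_diff (\<Union>i. A i) (\<Union>i. E i) \<subseteq> (\<Union>i. sym_diff (A i) (E i))" by blast
    have "\<mu> (sym_diff (\<Union>i. A i) (\<Union>i. E i)) \<le> \<mu> (\<Union>i. sym_diff (A i) (E i))"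
      using inc s n(2) unfolding increasing_def by (meson Pow_iff order_trans)
    then have "sym_diff (\<Union>i. A i) (\<Union>i. E i) \<in> null_sets M"
      unfolding nullM using n(1) order_trans[OF s n(2)] by simp
    with UE have "\<exists>E\<in>borel_sets_on Y. sym_diff (\<Union>i. A i) E \<in> null_sets M" by (rule rev_bexI)
    moreover have "(\<Union>i. A i) \<subseteq> Y" using AY by (rule UN_least)
    ultimately show "(\<Union>i. A i) \<in> completed_borel_sets Y \<mu>"
      by (simp only: iff simp_thms)
  qed
qed

lemma harmonic_sets_sigma_algebra:
  assumes "pre_harmonic_measure D \<omega>"
  shows "sigma_algebra (frontier D) (harmonic_sets D \<omega>)"
proof -
  let ?F = "\<lambda>x. completed_borel_sets (frontier D) (\<omega> x)"
  have "D \<noteq> {}" using assms by (auto simp: pre_harmonic_measure_def)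
  then obtain x0 where x0: "x0 \<in> D" by blast
  have sa: "sigma_algebra (frontier D) (?F x)" if "x \<in> D" for x
    using assms that by (auto simp: pre_harmonic_measure_def intro: completed_borel_sets_sigma_algebra)
  show ?thesis
    unfolding sigma_algebra_iff2 harmonic_sets_def
  proof (intro conjI ballI allI impI)
    show "(\<Inter>x\<in>D. ?F x) \<subseteq> Pow (frontier D)"
      using sa[OF x0] x0 unfolding sigma_algebra_iff2 by (meson INF_lower order_trans)
    show "{} \<in> (\<Inter>x\<in>D. ?F x)"
      using sa by (simp add: sigma_algebra_iff2)
    show "frontier D - s \<in> (\<Inter>x\<in>D. ?F x)" if "s \<in> (\<Inter>x\<in>D. ?F x)" for s
      using sa that by (simp add: sigma_algebra_iff2)
  next
    fix A :: "nat \<Rightarrow> 'a set" assume A: "range A \<subseteq> (\<Inter>x\<in>D. ?F x)"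
    have "(\<Union>i. A i) \<in> ?F x" if x: "x \<in> D" for x
    proof -
      have "range A \<subseteq> ?F x" using A x by (meson INF_lower order_trans)
      then show ?thesis using sa[OF x] unfolding sigma_algebra_iff2 by simp
    qed
    then show "(\<Union>i. A i) \<in> (\<Inter>x\<in>D. ?F x)" by simp
  qed
qed

lemma
  assumes "pre_harmonic_measure D \<omega>"
  shows space_harmonic_measure: "space (harmonic_measure D \<omega> x) = frontier D"
    and sets_harmonic_measure: "sets (harmonic_measure D \<omega> x) = harmonic_sets D \<omega>"
proof -
  interpret sigma_algebra "frontier D" "harmonic_sets D \<omega>"
    by (rule harmonic_sets_sigma_algebra) fact
  show "space (harmonic_measure D \<omega> x) = frontier D"
    "sets (harmonic_measure D \<omega> x) = harmonic_sets D \<omega>"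
    by (simp_all add: harmonic_measure_def space_closed sets_measure_of_eq)
qed

lemma emeasure_harmonic_measure:
  assumes D: "pre_harmonic_measure D \<omega>" and x: "x \<in> D" and E: "E \<in> harmonic_sets D \<omega>"
  shows "emeasure (harmonic_measure D \<omega> x) E = \<omega> x E"
proof -
  have bm: "borel_measure_on (frontier D) (\<omega> x)"
    using D x by (auto simp: pre_harmonic_measure_def)
  then have om: "measure_on (frontier D) (\<omega> x)" by (simp add: borel_measure_on_def)
  interpret P: sigma_algebra "frontier D" "Pow (frontier D)" by (rule sigma_algebra_Pow)
  let ?L = "lambda_system (frontier D) (Pow (frontier D)) (\<omega> x)"
  have "measure_space (frontier D) ?L (\<omega> x)" by (rule P.caratheodory_lemma[OF om])
  moreover have "harmonic_sets D \<omega> \<subseteq> ?L"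
    using completed_borel_sets_sigma_algebra(2)[OF bm] x by (auto simp: harmonic_sets_def)
  ultimately show ?thesis
    unfolding harmonic_measure_def using harmonic_sets_sigma_algebra[OF D] E
    by (intro emeasure_measure_of_sigma)
      (auto simp: measure_space_def positive_def countably_additive_def)
qed

end

theory Submission
  imports Defs
begin

text \<open>Write \<open>\<omega>_x(f)\<close> as the integral of \<open>f\<close> times the density
  of \<open>\<omega>_x\<close> with respect to \<open>\<omega>_y\<close>. If that density is at most
  \<open>C\<close> almost everywhere and \<open>f \<ge> 0\<close>, then
  \<open>\<omega>_x(f) \<le> C * \<omega>_y(f)\<close>, so every Harnack quotient is at most
  \<open>C\<close>. \<open>nn_integral_le_of_RN_deriv_le\<close> is this estimate for abstract
  measures; \<open>ennreal_harmonic_value\<close> carries it over to harmonic values, which are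
  Bochner integrals of functions nonnegative only modulo null sets.\<close>

lemma (in sigma_finite_measure) nn_integral_le_of_RN_deriv_le:
  assumes ac: "absolutely_continuous M N" and sets: "sets N = sets M"
    and bound: "AE z in M. RN_deriv M N z \<le> c"
    and u: "u \<in> borel_measurable M"
  shows "(\<integral>\<^sup>+z. u z \<partial>N) \<le> c * (\<integral>\<^sup>+z. u z \<partial>M)"
proof -
  have "(\<integral>\<^sup>+z. u z \<partial>N) = (\<integral>\<^sup>+z. RN_deriv M N z * u z \<partial>M)"
    using ac sets u by (rule RN_deriv_nn_integral)
  also have "\<dots> \<le> (\<integral>\<^sup>+z. c * u z \<partial>M)"
    using bound by (intro nn_integral_mono_AE) (auto elim!: eventually_mono intro: mult_right_mono)
  also have "\<dots> = c * (\<integral>\<^sup>+z. u z \<partial>M)"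
    using u by (rule nn_integral_cmult)
  finally show ?thesis .
qed

text \<open>Supplies the sigma-finiteness of the reference measure that Radon-Nikodym calculus
  requires.\<close>

lemma finite_measure_harmonic_measure:
  assumes D: "pre_harmonic_measure D \<omega>" and x: "x \<in> D"
  shows "finite_measure (harmonic_measure D \<omega> x)"
proof -
  have "emeasure (harmonic_measure D \<omega> x) (frontier D) = \<omega> x (frontier D)"
    using sets.top[of "harmonic_measure D \<omega> x"]
    by (intro emeasure_harmonic_measure[OF D x])
      (simp add: space_harmonic_measure[OF D] sets_harmonic_measure[OF D])
  moreover have "\<omega> x (frontier D) \<le> 1"
    using D x by (auto simp: pre_harmonic_measure_def)
  ultimately show ?thesis
    by (intro finite_measureI) (auto simp: space_harmonic_measure[OF D] top_unique)
qed

lemma AE_nonneg_of_harmonic_null: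
  assumes D: "pre_harmonic_measure D \<omega>" and x: "x \<in> D" and f: "f \<in> harmonic_L D \<omega>"
    and null: "harmonic_null D \<omega> {z \<in> frontier D. f z < 0}"
  shows "AE z in harmonic_measure D \<omega> x. 0 \<le> f z"
proof -
  let ?M = "harmonic_measure D \<omega> x"
  have [measurable]: "f \<in> borel_measurable ?M"
    using f x by (auto simp: harmonic_L_def)
  \<comment> \<open>\<open>harmonic_null\<close> speaks of the outer measure;
    \<open>emeasure\<close> agrees with it only on sets of the sigma-algebra, so membership comes
    first.\<close>
  have "{z \<in> space ?M. f z < 0} \<in> sets ?M" by measurable
  then have N: "{z \<in> frontier D. f z < 0} \<in> sets ?M"
    by (simp add: space_harmonic_measure[OF D])
  then have "emeasure ?M {z \<in> frontier D. f z < 0} = 0"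
    using emeasure_harmonic_measure[OF D x] null x
    by (simp add: sets_harmonic_measure[OF D] harmonic_null_def)
  with N show ?thesis
    by (intro AE_I[where N = "{z \<in> frontier D. f z < 0}"])
      (auto simp: space_harmonic_measure[OF D] not_le)
qed

text \<open>Since \<open>f\<close> is integrable and almost everywhere nonnegative, truncating it by
  \<open>ennreal\<close> changes it only on a null set.\<close>

lemma ennreal_harmonic_value:
  assumes D: "pre_harmonic_measure D \<omega>" and x: "x \<in> D" and f: "f \<in> harmonic_L D \<omega>"
    and null: "harmonic_null D \<omega> {z \<in> frontier D. f z < 0}"
  shows "ennreal (harmonic_value D \<omega> x f) = (\<integral>\<^sup>+z. ennreal (f z) \<partial>harmonic_measure D \<omega> x)"
  using f x AE_nonneg_of_harmonic_null[OF assms]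
  by (simp add: harmonic_value_def harmonic_L_def nn_integral_eq_integral)

text \<open>\<open>RN_deriv\<close> is a genuine density only under absolute continuity and is 0
  when no density exists; the definition of a pre-harmonic measure gives absolute continuity only
  within a component of \<open>D\<close>. As densities are unique only up to null sets, boundedness
  means an almost everywhere bound, with one \<open>C\<close> for all pairs.\<close>

theorem theorem2p18:
  fixes \<D> :: "'a::t2_space set set"
    and \<omega> :: "'a set \<Rightarrow> 'a \<Rightarrow> 'a set \<Rightarrow> ennreal"
    and D A :: "'a set"
  assumes "radon_harmonic_measure_system \<D> \<omega>"
    and "D \<in> \<D>"
    and "A \<subseteq> D"
    and "\<And>x y. x \<in> A \<Longrightarrow> y \<in> A \<Longrightarrow>
           absolutely_continuous (harmonic_measure D (\<omega> D) y) (harmonic_measure D (\<omega> D) x)"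
    and "\<exists>C::real. \<forall>x\<in>A. \<forall>y\<in>A. AE z in harmonic_measure D (\<omega> D) y.
           RN_deriv (harmonic_measure D (\<omega> D) y) (harmonic_measure D (\<omega> D) x) z \<le> ennreal C"
  shows "harnack_index A D (\<omega> D) < \<infinity>"
proof -
  let ?M = "harmonic_measure D (\<omega> D)"
  have D: "pre_harmonic_measure D (\<omega> D)"
    using assms(1,2) by (simp add: radon_harmonic_measure_system_def
      harmonic_measure_system_def continuous_harmonic_measure_def)
  obtain C :: real where C: "\<And>x y. x \<in> A \<Longrightarrow> y \<in> A \<Longrightarrow> AE z in ?M y. RN_deriv (?M y) (?M x) z \<le> ennreal C"
    using assms(5) by blast
  have "ennreal (harmonic_value D (\<omega> D) x f) / ennreal (harmonic_value D (\<omega> D) y f) \<le> ennreal C"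
    if x: "x \<in> A" and y: "y \<in> A" and f: "f \<in> harmonic_L D (\<omega> D)"
      and null: "harmonic_null D (\<omega> D) {z \<in> frontier D. f z < 0}" for x y f
  proof -
    let ?a = "ennreal (harmonic_value D (\<omega> D) x f)" and ?b = "ennreal (harmonic_value D (\<omega> D) y f)"
    have xD: "x \<in> D" and yD: "y \<in> D" using x y assms(3) by auto
    interpret finite_measure "?M y" using D yD by (rule finite_measure_harmonic_measure)
    have "(\<lambda>z. ennreal (f z)) \<in> borel_measurable (?M y)"
      using f yD by (auto simp: harmonic_L_def)
    then have le: "?a \<le> ennreal C * ?b"
      unfolding ennreal_harmonic_value[OF D xD f null] ennreal_harmonic_value[OF D yD f null]
      using assms(4)[OF x y] C[OF x y]
      by (intro nn_integral_le_of_RN_deriv_le) (simp_all add: sets_harmonic_measure[OF D])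
    show ?thesis
    proof (cases "?b = 0")
      \<comment> \<open>Here the estimate forces the numerator to vanish too, and
        \<open>0 / 0 = 0\<close> in \<open>ennreal\<close>; this covers pairs in different
        components.\<close>
      case True
      then have "?a = 0" using le by (metis le_zero_eq mult_zero_right)
      then show ?thesis by simp
    next
      case False
      then show ?thesis using le
        by (intro divide_le_posI_ennreal) (auto simp: zero_less_iff_neq_zero mult.commute)
    qed
  qed
  \<comment> \<open>The bound is uniform in \<open>x\<close>, \<open>y\<close> and \<open>f\<close>,
    so it passes to the supremum.\<close>
  then have "harnack_index A D (\<omega> D) \<le> ennreal C"
    unfolding harnack_index_def by (intro Sup_least) blast
  also have "\<dots> < \<infinity>" by simp
  finally show ?thesis .
qed

end
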